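(* The following hold for finite connected graphs. (1) If $\Gamma$ is an integrable graph and $\Gamma'$ is obtained from $\Gamma$ by adding one extra vertex connected to the existing graph $\Gamma$ by at least three extra edges, then $\Gamma'$ is integrable. (2) If $\Gamma$ is an integrable graph and $\Gamma'$ is obtained from $\Gamma$ by adding extra edges (between existing vertices), then $\Gamma'$ is integrable. (3) If $\Gamma_1$ and $\Gamma_2$ are disjoint integrable graphs and $\Gamma'$ is obtained by joining them at a vertex (i.e. identifying one vertex of $\Gamma_1$ with one vertex of $\Gamma_2$), then $\Gamma'$ is integrable.
   Context: Let $H$ denote three-dimensional hyperbolic space (constant curvature $-1$) with distance function $d$ and Riemannian volume measure $\mathrm{d}x$ (in geodesic spherical coordinates about a point, $\mathrm{d}x=\sinh^2 r\,\mathrm{d}r\,\mathrm{d}\Omega$, with $\mathrm{d}\Omega$ Lebesgue measure on the unit 2-sphere). For $p\ge 0$ and $x,y\in H$ with $r=d(x,y)$, put $K_p(x,y)=K_p(r)=\frac{\sin pr}{p\sinh r}$ for $p,r>0$, extended continuously to $p,r\ge 0$: $K_p(0)=1$ and $K_0(r)=r/\sinh r$. Graphs are finite and connected; multiple edges and loops are allowed. Let $\Gamma$ be such a graph with vertex set $V$ and edge set $E$, and let $p\colon E\to[0,\infty)$ be a labelling of the edges. Let $s(e),t(e)$ be the two endpoints of $e\in E$ (in either order; $K_p$ is symmetric), choose a vertex $w\in V$ and a point $x_w\in H$, and let $V'=V\setminus\{w\}$. The labelled graph $(\Gamma,p)$ (a relativistic spin network) is called integrable if $$\int_{H^{V'}}\Big|\prod_{e\in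 E}K_{p(e)}(x_{s(e)},x_{t(e)})\Big|\prod_{v\in V'}\mathrm{d}x_v<\infty .$$ By invariance under the isometries of $H$ this does not depend on the choice of $w$ and $x_w$. The graph $\Gamma$ is called integrable if $(\Gamma,p)$ is integrable for every choice of edge labels $p\colon E\to[0,\infty)$. *)

theory Defs
  imports "HOL-Analysis.Analysis" "Graph_Theory.Digraph_Component"
begin

text \<open>Hyperbolic 3-space in the upper half-space model, with metric
  \<open>(\<bar>dz\<bar>\<^sup>2 + dt\<^sup>2) / t\<^sup>2\<close> on pairs \<open>(z, t)\<close> with \<open>t > 0\<close>.\<close>

definition hspace :: "(complex \<times> real) set" where
  "hspace = {x. snd x > 0}"

text \<open>The library distance on \<open>complex \<times> real\<close> is the Euclidean one, so this is
  \<open>cosh d = 1 + (\<bar>z - z'\<bar>\<^sup>2 + (t - t')\<^sup>2) / (2 t t')\<close>.\<close>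

definition hdist :: "complex \<times> real \<Rightarrow> complex \<times> real \<Rightarrow> real" where
  "hdist x y = arcosh (1 + (dist x y)\<^sup>2 / (2 * snd x * snd y))"

definition hvol :: "(complex \<times> real) measure" where
  "hvol = density (restrict_space lborel hspace) (\<lambda>x. ennreal (1 / snd x ^ 3))"

definition hkernel :: "real \<Rightarrow> real \<Rightarrow> real" where
  "hkernel p r =
     (if r = 0 then 1 else if p = 0 then r / sinh r else sin (p * r) / (p * sinh r))"

text \<open>An undirected multigraph, possibly with loops, is represented by a directed one with an
  arbitrary orientation of every edge. The library notion of connectedness for directed graphs
  ignores the orientation and includes nonemptiness; its name is qualified because it clashes with
  topological connectedness.\<close>

definition fin_conn_graph :: "('a, 'b) pre_digraph \<Rightarrow> bool" where
  "fin_conn_graph G \<longleftrightarrow> fin_digraph G \<and> Digraph_Component.connected G"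

definition network_integral ::
  "('a, 'b) pre_digraph \<Rightarrow> ('b \<Rightarrow> real) \<Rightarrow> 'a \<Rightarrow> complex \<times> real \<Rightarrow> ennreal" where
  "network_integral G p w a =
     (\<integral>\<^sup>+ x. ennreal \<bar>\<Prod>e\<in>arcs G.
         hkernel (p e) (hdist ((x(w := a)) (tail G e)) ((x(w := a)) (head G e)))\<bar>
      \<partial>(\<Pi>\<^sub>M v\<in>verts G - {w}. hvol))"

text \<open>By isometry invariance, finiteness of the integral does not depend on the base vertex
  and its position, so one may equally well ask for it at every choice of them.\<close>

definition integrable_network :: "('a, 'b) pre_digraph \<Rightarrow> ('b \<Rightarrow> real) \<Rightarrow> bool" where
  "integrable_network G p \<longleftrightarrow>
     (\<forall>w\<in>verts G. \<forall>a\<in>hspace. network_integral G p w a < \<infinity>)"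

definition integrable_graph :: "('a, 'b) pre_digraph \<Rightarrow> bool" where
  "integrable_graph G \<longleftrightarrow>
     fin_conn_graph G \<and> (\<forall>p. (\<forall>e\<in>arcs G. p e \<ge> 0) \<longrightarrow> integrable_network G p)"

text \<open>The endpoint maps of two graphs are only compared on common edges, since their values
  elsewhere carry no meaning (the library's \<open>subgraph\<close> requires them to agree everywhere).\<close>

definition keeps_edges :: "('a, 'b) pre_digraph \<Rightarrow> ('a, 'b) pre_digraph \<Rightarrow> bool" where
  "keeps_edges G G' \<longleftrightarrow>
     arcs G \<subseteq> arcs G' \<and> (\<forall>e\<in>arcs G. tail G' e = tail G e \<and> head G' e = head G e)"

definition adds_vertex :: "('a, 'b) pre_digraph \<Rightarrow> ('a, 'b) pre_digraph \<Rightarrow> bool" where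
  "adds_vertex G G' \<longleftrightarrow> keeps_edges G G' \<and>
     (\<exists>v. v \<notin> verts G \<and> verts G' = insert v (verts G) \<and>
        (\<forall>e\<in>arcs G' - arcs G.
           (tail G' e = v \<and> head G' e \<in> verts G) \<or> (tail G' e \<in> verts G \<and> head G' e = v)))"

definition adds_edges :: "('a, 'b) pre_digraph \<Rightarrow> ('a, 'b) pre_digraph \<Rightarrow> bool" where
  "adds_edges G G' \<longleftrightarrow> keeps_edges G G' \<and> verts G' = verts G \<and>
     (\<forall>e\<in>arcs G' - arcs G. tail G' e \<in> verts G \<and> head G' e \<in> verts G)"

text \<open>The union of two disjoint graphs with \<open>v\<^sub>2\<close> identified with \<open>v\<^sub>1\<close>; the identified vertex
  keeps the name \<open>v\<^sub>1\<close>.\<close>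

definition join_at ::
  "('a, 'b) pre_digraph \<Rightarrow> 'a \<Rightarrow> ('a, 'b) pre_digraph \<Rightarrow> 'a \<Rightarrow> ('a, 'b) pre_digraph" where
  "join_at G\<^sub>1 v\<^sub>1 G\<^sub>2 v\<^sub>2 =
     (let glue = (\<lambda>v. if v = v\<^sub>2 then v\<^sub>1 else v) in
      \<lparr> verts = verts G\<^sub>1 \<union> glue ` verts G\<^sub>2,
        arcs = arcs G\<^sub>1 \<union> arcs G\<^sub>2,
        tail = (\<lambda>e. if e \<in> arcs G\<^sub>1 then tail G\<^sub>1 e else glue (tail G\<^sub>2 e)),
        head = (\<lambda>e. if e \<in> arcs G\<^sub>1 then head G\<^sub>1 e else glue (head G\<^sub>2 e)) \<rparr>)"

end

theory Submission
  imports Defs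
begin

text \<open>All kernels are dominated by \<open>K\<^sub>0(r) = r / sinh r \<le> 1\<close>, which gives (2). As \<open>r\<close> is at most a
  multiple of \<open>exp (r / 6)\<close>, the cube of \<open>K\<^sub>0\<close> decays like \<open>(cosh r) powr (-5/2)\<close>, faster than the volume
  growth \<open>exp (2 r)\<close>, hence its integral over \<open>H\<close> is a finite constant, independent of the centre. A product
  of at least three numbers in \<open>[0, 1]\<close> is at most the sum of their cubes, so the edges at a new
  vertex contribute a finite factor, which is (1). Translations and dilations of the upper
  half-space act transitively and preserve distance and volume, so the network integral does not depend on the
  position of the base vertex; by Tonelli the integral of a join is then the product of the two integrals,
  which is (3).\<close>

subsection \<open>The kernel\<close>

lemma hdist_sym: "hdist x y = hdist y x"
  by (simp add: hdist_def dist_commute mult.commute mult.left_commute)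

lemma hdist_arg_ge_1:
  assumes "x \<in> hspace" "y \<in> hspace"
  shows "1 + (dist x y)\<^sup>2 / (2 * snd x * snd y) \<ge> 1"
  using assms by (simp add: hspace_def)

lemma hdist_nonneg:
  assumes "x \<in> hspace" "y \<in> hspace"
  shows "hdist x y \<ge> 0"
  unfolding hdist_def using hdist_arg_ge_1[OF assms] by simp

lemma cosh_hdist:
  assumes "x \<in> hspace" "y \<in> hspace"
  shows "cosh (hdist x y) = 1 + (dist x y)\<^sup>2 / (2 * snd x * snd y)"
  unfolding hdist_def using hdist_arg_ge_1[OF assms] by simp

lemma sinh_ge_self:
  fixes r :: real
  assumes "0 \<le> r"
  shows "r \<le> sinh r"
proof -
  have "sinh 0 - 0 \<le> sinh r - r"
    by (rule DERIV_nonneg_imp_nondecreasing[OF assms])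
       (auto intro!: derivative_eq_intros exI simp: cosh_real_ge_1)
  then show ?thesis by simp
qed

lemma hkernel_0_nonneg: "0 \<le> r \<Longrightarrow> 0 \<le> hkernel 0 r"
  by (simp add: hkernel_def)

lemma hkernel_0_le_1: "0 \<le> r \<Longrightarrow> hkernel 0 r \<le> 1"
  using sinh_ge_self[of r] by (simp add: hkernel_def divide_le_eq_1)

text \<open>The inequality |sin (p r)| <= |p| r cancels the p in the denominator, so all later
  estimates are uniform in the edge labels.\<close>

lemma abs_hkernel_le:
  assumes "0 \<le> r"
  shows "\<bar>hkernel p r\<bar> \<le> hkernel 0 r"
proof (cases "r = 0 \<or> p = 0")
  case True
  then show ?thesis
    using assms by (auto simp: hkernel_def)
next
  case False
  with assms have r: "r > 0" "sinh r > 0" by auto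
  have "\<bar>sin (p * r)\<bar> \<le> \<bar>p\<bar> * r"
    using abs_sin_x_le_abs_x[of "p * r"] r by (simp add: abs_mult)
  then show ?thesis
    using False r by (simp add: hkernel_def abs_mult field_simps)
qed

lemma abs_hkernel_le_1: "0 \<le> r \<Longrightarrow> \<bar>hkernel p r\<bar> \<le> 1"
  using abs_hkernel_le hkernel_0_le_1 by (meson order_trans)

text \<open>After rearrangement and multiplication by 2 exp r this is 1 + 2 r <= exp (2 r). For r >
  0 it gives K_0(r) cosh r <= 1 + r, that is, decay like 1 / cosh r up to a linear factor.\<close>

lemma mult_cosh_le:
  fixes r :: real
  assumes "0 \<le> r"
  shows "r * cosh r \<le> (1 + r) * sinh r"
proof -
  have "1 + 2 * r \<le> exp (2 * r)" by (rule exp_ge_add_one_self)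
  then have "(1 + 2 * r) * exp (-r) \<le> exp (2 * r) * exp (-r)" by simp
  also have "\<dots> = exp r" by (simp flip: exp_add)
  finally show ?thesis
    by (simp add: cosh_def sinh_def field_simps)
qed

text \<open>In the sixth power of K_0(r) cosh r <= 1 + r, the linear factor costs only one of the
  six powers of cosh. Six is twice the exponent 3 that is wanted in the end.\<close>

lemma one_plus_power_6_le_cosh:
  fixes r :: real
  assumes "0 \<le> r"
  shows "(1 + r) ^ 6 \<le> 2 * 6 ^ 6 * cosh r"
proof -
  have "1 + r \<le> 6 * (1 + r / 6)" using assms by simp
  also have "\<dots> \<le> 6 * exp (r / 6)" using exp_ge_add_one_self[of "r / 6"] by (intro mult_left_mono) auto
  finally have "(1 + r) ^ 6 \<le> (6 * exp (r / 6)) ^ 6"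
    using assms by (intro power_mono) auto
  also have "\<dots> = 6 ^ 6 * exp r" by (simp add: power_mult_distrib flip: exp_of_nat_mult)
  also have "\<dots> \<le> 6 ^ 6 * (2 * cosh r)" by (simp add: cosh_def)
  finally show ?thesis by simp
qed

text \<open>For k = K_0(r) and c = cosh r the two preceding bounds give k^6 c^6 <= 2 * 6^6 c; it
  remains to divide by c and take the square root.\<close>

lemma hkernel_0_cube_le:
  assumes "0 \<le> r"
  shows "hkernel 0 r ^ 3 \<le> 432 * cosh r powr (-5/2)"
proof (cases "r = 0")
  case True
  then show ?thesis by (simp add: hkernel_def)
next
  case False
  define c where "c = cosh r"
  have c: "c \<ge> 1" by (simp add: c_def cosh_real_ge_1)
  define k where "k = hkernel 0 r"
  have k: "k \<ge> 0" using assms hkernel_0_nonneg k_def by simp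
  have "k * c \<le> 1 + r"
    using False assms mult_cosh_le[OF assms] by (simp add: k_def c_def hkernel_def field_simps)
  then have "(k * c) ^ 6 \<le> (1 + r) ^ 6"
    using c k by (intro power_mono) auto
  also have "\<dots> \<le> 2 * 6 ^ 6 * c"
    using one_plus_power_6_le_cosh[OF assms] by (simp add: c_def)
  finally have "k ^ 6 * c ^ 5 * c \<le> 2 * 6 ^ 6 * c"
    by (simp add: power_mult_distrib eval_nat_numeral mult_ac)
  then have *: "k ^ 6 * c ^ 5 \<le> 2 * 6 ^ 6"
    using c by simp
  have "(k ^ 3 * c powr (5/2))\<^sup>2 = k ^ 6 * c ^ 5"
  proof -
    have "(c powr (5/2))\<^sup>2 = c powr (5/2 * 2)"
      by (subst powr_powr[symmetric]) (use c in simp)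
    also have "\<dots> = c ^ 5" using c by (simp add: powr_numeral)
    finally show ?thesis by (simp add: power_mult_distrib flip: power_mult)
  qed
  \<comment> \<open>432 = 2 * 6^3: its square 4 * 6^6 lies above 2 * 6^6, which avoids an irrational
    constant.\<close>
  also have "\<dots> \<le> 432\<^sup>2" using * by simp
  finally have "k ^ 3 * c powr (5/2) \<le> 432"
    by (rule power2_le_imp_le) simp
  then show ?thesis
    using c by (simp add: powr_minus_divide field_simps flip: k_def c_def)
qed

subsection \<open>The volume measure and its similarities\<close>

lemma borel_measurable_snd [measurable (raw)]:
  fixes f :: "'a \<Rightarrow> 'b::second_countable_topology \<times> 'c::second_countable_topology"
  assumes "f \<in> borel_measurable M"
  shows "(\<lambda>x. snd (f x)) \<in> borel_measurable M"
  using assms by (rule borel_measurable_continuous_on[OF continuous_on_snd[OF continuous_on_id]])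

lemma hdist_measurable [measurable]:
  assumes [measurable]: "f \<in> borel_measurable M" "g \<in> borel_measurable M"
  shows "(\<lambda>x. hdist (f x) (g x)) \<in> borel_measurable M"
  unfolding hdist_def arcosh_def by measurable

lemma hkernel_measurable [measurable]: "hkernel p \<in> borel_measurable borel"
proof -
  have [measurable]: "(sinh :: real \<Rightarrow> real) \<in> borel_measurable borel"
    by (intro borel_measurable_continuous_onI continuous_intros)
  show ?thesis unfolding hkernel_def by measurable
qed

lemma hspace_measurable [measurable]: "hspace \<in> sets borel"
  unfolding hspace_def by measurable

lemma space_hvol [simp]: "space hvol = hspace"
  by (simp add: hvol_def space_restrict_space)

lemma sets_hvol: "sets hvol = sets (restrict_space borel hspace)"
  by (simp add: hvol_def cong: sets_restrict_space_cong)

lemma measurable_hvol_borel: "f \<in> borel_measurable borel \<Longrightarrow> f \<in> borel_measurable hvol"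
  by (simp add: measurable_cong_sets[OF sets_hvol refl] measurable_restrict_space1)

text \<open>Moving the half-space into an indicator makes affine substitution and factorisation over
  the coordinates of \<open>lborel\<close> applicable.\<close>

lemma nn_integral_hvol:
  assumes "f \<in> borel_measurable borel"
  shows "(\<integral>\<^sup>+x. f x \<partial>hvol) = (\<integral>\<^sup>+x. ennreal (1 / snd x ^ 3) * f x * indicator hspace x \<partial>lborel)"
proof -
  have [measurable]: "f \<in> borel_measurable (restrict_space lborel hspace)"
    using assms by (simp add: measurable_restrict_space1)
  have [measurable]: "(\<lambda>x. ennreal (1 / snd x ^ 3)) \<in> borel_measurable (restrict_space lborel hspace)"
    by (intro measurable_restrict_space1) measurable
  show ?thesis
    unfolding hvol_def
    by (subst nn_integral_density) (auto simp: nn_integral_restrict_space)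
qed

text \<open>A density with finite values keeps a sigma-finite measure sigma-finite; product measures
  and Tonelli's theorem rest on this.\<close>

lemma sigma_finite_hvol: "sigma_finite_measure hvol"
proof -
  interpret R: sigma_finite_measure "restrict_space (lborel :: (complex \<times> real) measure) hspace"
    by (rule sigma_finite_measure_restrict_space) (auto intro: sigma_finite_lborel)
  have [measurable]: "(\<lambda>x. ennreal (1 / snd x ^ 3)) \<in> borel_measurable (restrict_space lborel hspace)"
    by (intro measurable_restrict_space1) measurable
  show ?thesis unfolding hvol_def
    by (subst R.sigma_finite_iff_density_finite) auto
qed

interpretation hvol: product_sigma_finite "\<lambda>_ :: 'v. hvol"
  by (simp add: product_sigma_finite_def sigma_finite_hvol)

text \<open>These isometries already act transitively, so the full isometry group is not needed.\<close>

definition similarity :: "complex \<Rightarrow> real \<Rightarrow> complex \<times> real \<Rightarrow> complex \<times> real" where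
  "similarity b l x = (b, 0) + l *\<^sub>R x"

lemma snd_similarity [simp]: "snd (similarity b l x) = l * snd x"
  by (simp add: similarity_def)

lemma similarity_in_hspace [simp]: "l > 0 \<Longrightarrow> similarity b l x \<in> hspace \<longleftrightarrow> x \<in> hspace"
  by (simp add: hspace_def zero_less_mult_iff)

lemma similarity_measurable [measurable]: "similarity b l \<in> borel_measurable borel"
  unfolding similarity_def by measurable

text \<open>The squared Euclidean distance and the product of the heights both scale by l^2, so
  their quotient inside arcosh is unchanged.\<close>

lemma hdist_similarity [simp]:
  assumes "l > 0"
  shows "hdist (similarity b l x) (similarity b l y) = hdist x y"
proof -
  have "dist (similarity b l x) (similarity b l y) = l * dist x y"
    using assms by (simp add: similarity_def dist_norm flip: scaleR_diff_right)
  then show ?thesis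
    using assms by (simp add: hdist_def power2_eq_square mult.assoc)
qed

lemma similarity_transitive:
  assumes "x \<in> hspace" "y \<in> hspace"
  obtains b l where "l > 0" "similarity b l x = y"
proof
  \<comment> \<open>The dilation factor is the ratio of the heights; the horizontal shift then
    corrects the complex coordinate.\<close>
  show "snd y / snd x > 0" using assms by (simp add: hspace_def)
  show "similarity (fst y - (snd y / snd x) *\<^sub>R fst x) (snd y / snd x) x = y"
    using assms by (simp add: similarity_def hspace_def prod_eq_iff)
qed

text \<open>The Jacobian l^3 of the affine substitution in three dimensions cancels the factor l^-3
  that the density acquires when the height t becomes l t.\<close>

lemma nn_integral_hvol_similarity:
  assumes [measurable]: "f \<in> borel_measurable borel" and l: "l > 0"
  shows "(\<integral>\<^sup>+x. f (similarity b l x) \<partial>hvol) = (\<integral>\<^sup>+x. f x \<partial>hvol)"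
proof -
  define g where "g x = ennreal (1 / snd x ^ 3) * f x * indicator hspace x" for x :: "complex \<times> real"
  have [measurable]: "g \<in> borel_measurable borel" unfolding g_def by measurable
  have "(\<integral>\<^sup>+x. f x \<partial>hvol) = (\<integral>\<^sup>+x. g x \<partial>lborel)"
    by (simp add: nn_integral_hvol g_def)
  also have "\<dots> = (\<integral>\<^sup>+x. ennreal (l ^ 3) * g (similarity b l x) \<partial>lborel)"
    using l by (subst lborel_affine[of l "(b, 0)"])
      (auto simp: nn_integral_density nn_integral_distr similarity_def)
  also have "\<dots> = (\<integral>\<^sup>+x. ennreal (1 / snd x ^ 3) * f (similarity b l x) * indicator hspace x \<partial>lborel)"
  proof (rule nn_integral_cong)
    fix x
    have "ennreal (l ^ 3) * ennreal (1 / (l * snd x) ^ 3) = ennreal (1 / snd x ^ 3)" if "x \<in> hspace"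
      using that l by (simp add: hspace_def field_simps flip: ennreal_mult)
    then show "ennreal (l ^ 3) * g (similarity b l x)
        = ennreal (1 / snd x ^ 3) * f (similarity b l x) * indicator hspace x"
      using l by (auto simp: g_def indicator_def simp flip: mult.assoc)
  qed
  also have "\<dots> = (\<integral>\<^sup>+x. f (similarity b l x) \<partial>hvol)"
    by (simp add: nn_integral_hvol)
  finally show ?thesis ..
qed

lemma similarity_measurable_hvol [measurable]:
  assumes "l > 0"
  shows "similarity b l \<in> measurable hvol hvol"
proof -
  have "similarity b l \<in> measurable hvol (restrict_space borel hspace)"
    using assms by (intro measurable_restrict_space2 measurable_hvol_borel) auto
  then show ?thesis
    by (simp add: measurable_cong_sets[OF refl sets_hvol])
qed

text \<open>Applying the integral form to indicators yields invariance of the measure itself, the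
  form that lifts to product measures.\<close>

lemma distr_hvol_similarity:
  assumes l: "l > 0"
  shows "distr hvol hvol (similarity b l) = hvol"
proof (rule measure_eqI)
  show "sets (distr hvol hvol (similarity b l)) = sets hvol" by simp
next
  fix A assume "A \<in> sets (distr hvol hvol (similarity b l))"
  then have A [measurable]: "A \<in> sets hvol" by simp
  \<comment> \<open>Because \<open>hspace\<close> is Borel, the measurable sets of
    \<open>hvol\<close> are Borel in the ambient space, so their indicators fall under the integral
    form.\<close>
  then have [measurable]: "A \<in> sets borel" and AH: "A \<subseteq> hspace"
    using hspace_measurable by (auto simp: sets_hvol sets_restrict_space_iff)
  note [measurable] = similarity_measurable_hvol[OF l]
  have "emeasure (distr hvol hvol (similarity b l)) A
      = (\<integral>\<^sup>+x. indicator A x \<partial>distr hvol hvol (similarity b l))"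
    by (simp add: A)
  also have "\<dots> = (\<integral>\<^sup>+x. indicator A (similarity b l x) \<partial>hvol)"
    by (subst nn_integral_distr) auto
  also have "\<dots> = (\<integral>\<^sup>+x. indicator A x \<partial>hvol)"
    by (rule nn_integral_hvol_similarity[OF _ l]) simp
  also have "\<dots> = emeasure hvol A" by simp
  finally show "emeasure (distr hvol hvol (similarity b l)) A = emeasure hvol A" .
qed

subsection \<open>The cube of the kernel is integrable\<close>

text \<open>The exponent -1/2 is integrable at 0 and -3/2 at infinity. Both the horizontal and the
  vertical factor of the volume integral are treated this way.\<close>

lemma nn_integral_lborel_le_powr:
  fixes f :: "real \<Rightarrow> real"
  assumes [measurable]: "f \<in> borel_measurable borel"
    and f0: "\<And>u. 0 < u \<Longrightarrow> u \<le> 1 \<Longrightarrow> f u \<le> u powr (-1/2)"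
    and f1: "\<And>u. 1 \<le> u \<Longrightarrow> f u \<le> u powr (-3/2)"
  shows "(\<integral>\<^sup>+u. ennreal (f u) * indicator {0<..} u \<partial>lborel) < \<infinity>"
proof -
  have 1: "(\<integral>\<^sup>+u. ennreal (indicator {0..1} u * u powr (-1/2)) \<partial>lborel) < \<infinity>"
    using nn_integral_has_integral_lebesgue[OF _ has_integral_powr_from_0[of "-1/2" 1]]
    by simp
  have 2: "(\<integral>\<^sup>+u. ennreal (indicator {1..} u * u powr (-3/2)) \<partial>lborel) < \<infinity>"
    using nn_integral_has_integral_lebesgue[OF _ has_integral_powr_to_inf[of "-3/2" 1]]
    by simp
  have "(\<integral>\<^sup>+u. ennreal (f u) * indicator {0<..} u \<partial>lborel)
    \<le> (\<integral>\<^sup>+u. ennreal (indicator {0..1} u * u powr (-1/2)) + ennreal (indicator {1..} u * u powr (-3/2)) \<partial>lborel)"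
  proof (rule nn_integral_mono)
    fix u :: real
    consider "u \<le> 0" | "0 < u" "u \<le> 1" | "1 \<le> u" by linarith
    then show "ennreal (f u) * indicator {0<..} u
      \<le> ennreal (indicator {0..1} u * u powr (-1/2)) + ennreal (indicator {1..} u * u powr (-3/2))"
    proof cases
      case 2
      then show ?thesis using f0[of u] by (auto intro: add_increasing2 ennreal_leI)
    next
      case 3
      then show ?thesis using f1[of u] by (auto intro: add_increasing ennreal_leI)
    qed simp
  qed
  also have "\<dots> < \<infinity>"
    using 1 2 by (subst nn_integral_add) auto
  finally show ?thesis .
qed

lemma nn_integral_lborel_even:
  fixes f :: "real \<Rightarrow> ennreal"
  assumes [measurable]: "f \<in> borel_measurable borel" and even: "\<And>u. f (-u) = f u"
  shows "(\<integral>\<^sup>+u. f u \<partial>lborel) = 2 * (\<integral>\<^sup>+u. f u * indicator {0<..} u \<partial>lborel)"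
proof -
  \<comment> \<open>The two half-lines miss only u = 0, which is a null set.\<close>
  have "(\<integral>\<^sup>+u. f u \<partial>lborel)
      = (\<integral>\<^sup>+u. f u * indicator {0<..} u + f u * indicator {0<..} (-u) \<partial>lborel)"
    using AE_lborel_singleton[of "0::real"]
    by (intro nn_integral_cong_AE) (auto elim!: eventually_mono simp: indicator_def)
  also have "\<dots> = (\<integral>\<^sup>+u. f u * indicator {0<..} u \<partial>lborel)
      + (\<integral>\<^sup>+u. f u * indicator {0<..} (-u) \<partial>lborel)"
    by (rule nn_integral_add) auto
  also have "(\<integral>\<^sup>+u. f u * indicator {0<..} (-u) \<partial>lborel)
      = (\<integral>\<^sup>+u. f u * indicator {0<..} u \<partial>lborel)"
    by (subst nn_integral_real_affine[of _ "-1" 0]) (auto simp: even)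
  finally show ?thesis by (simp add: mult_2)
qed

lemma Basis_complex_real:
  "(Basis :: (complex \<times> real) set) = {(1, 0), (\<i>, 0), (0, 1)}"
  by (auto simp: Basis_prod_def Basis_complex_def)

text \<open>In the upper half-space \<open>cosh d = A / (2 t)\<close> with \<open>A = 1 + t\<^sup>2 + (Re z)\<^sup>2 + (Im z)\<^sup>2\<close>. The exponent \<open>-5/2\<close> of
  \<open>A\<close> is split as \<open>-1 - 3/4 - 3/4\<close>, and each factor is bounded by the contribution of one coordinate, so
  that the volume integral becomes a product of three convergent one-dimensional integrals.\<close>

lemma hkernel_0_cube_le_product:
  assumes t: "t > 0"
  shows "1 / t ^ 3 * hkernel 0 (hdist (z, t) (0, 1)) ^ 3
    \<le> 432 * 2 powr (5/2) * ((1 + (Re z)\<^sup>2) powr (-3/4) * (1 + (Im z)\<^sup>2) powr (-3/4)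
        * (t powr (-1/2) * (1 + t\<^sup>2) powr (-1)))"
proof -
  define A where "A = 1 + t\<^sup>2 + (Re z)\<^sup>2 + (Im z)\<^sup>2"
  have A: "A > 0" unfolding A_def by (intro add_pos_nonneg) auto
  have H: "(z, t) \<in> hspace" "(0, 1) \<in> hspace" using t by (auto simp: hspace_def)
  have "(dist (z, t) (0, 1))\<^sup>2 = (Re z)\<^sup>2 + (Im z)\<^sup>2 + (t - 1)\<^sup>2"
    by (simp add: dist_Pair_Pair dist_real_def cmod_power2)
  then have "cosh (hdist (z, t) (0, 1)) = A / (2 * t)"
    using t by (simp add: cosh_hdist[OF H] A_def field_simps power2_eq_square)
  then have "1 / t ^ 3 * hkernel 0 (hdist (z, t) (0, 1)) ^ 3
      \<le> 1 / t ^ 3 * (432 * (A / (2 * t)) powr (-5/2))"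
    using hkernel_0_cube_le[OF hdist_nonneg[OF H]] t by (intro mult_left_mono) auto
  also have "\<dots> = 432 * 2 powr (5/2) * (A powr (-5/2) * t powr (-1/2))"
  proof -
    have "(A / (2 * t)) powr (-5/2) = A powr (-5/2) * (2 powr (5/2) * t powr (5/2))"
      using A t by (simp add: powr_divide powr_mult powr_minus field_simps)
    \<comment> \<open>The density t^-3 and the power t^(5/2) coming from cosh combine to
      t^(-1/2).\<close>
    moreover have "t powr (5/2) = t powr (-1/2) * t ^ 3"
      using t by (simp flip: powr_numeral powr_add)
    ultimately show ?thesis using t by simp
  qed
  also have "A powr (-5/2) = A powr (-3/4) * A powr (-3/4) * A powr (-1)"
    by (simp only: powr_add[symmetric]) simp
  also have "432 * 2 powr (5/2) * (A powr (-3/4) * A powr (-3/4) * A powr (-1) * t powr (-1/2))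
     \<le> 432 * 2 powr (5/2) * ((1 + (Re z)\<^sup>2) powr (-3/4) * (1 + (Im z)\<^sup>2) powr (-3/4)
        * (1 + t\<^sup>2) powr (-1) * t powr (-1/2))"
    by (intro mult_left_mono mult_right_mono mult_mono powr_mono2')
       (auto simp: A_def intro: add_pos_nonneg)
  finally show ?thesis by (simp only: mult_ac)
qed

lemma nn_integral_hkernel_0_cube_origin:
  "(\<integral>\<^sup>+x. ennreal (hkernel 0 (hdist x (0, 1)) ^ 3) \<partial>hvol) < \<infinity>"
proof -
  \<comment> \<open>\<open>Z\<close> is the factor of each horizontal coordinate and
    \<open>T\<close> that of the height; \<open>F\<close> indexes them by basis vectors, as the
    product formula requires. The indicator in \<open>T\<close> takes over the restriction to the
    half-space.\<close>
  define Z where "Z u = ennreal ((1 + u\<^sup>2) powr (-3/4))" for u :: real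
  define T where "T t = ennreal (t powr (-1/2) * (1 + t\<^sup>2) powr (-1)) * indicator {0<..} t" for t :: real
  define F where "F b = (if b = (0, 1) then T else Z)" for b :: "complex \<times> real"
  have [measurable]: "Z \<in> borel_measurable borel" "T \<in> borel_measurable borel"
    unfolding Z_def T_def by measurable
  have ennreal_mult4: "ennreal (k * (q * r * s)) = ennreal k * (ennreal q * ennreal r * ennreal s)"
    if "k \<ge> 0" "q \<ge> 0" "r \<ge> 0" "s \<ge> 0" for k q r s
    using that by (simp add: ennreal_mult)
  have FB: "F b \<in> borel_measurable borel" for b by (simp add: F_def)
  \<comment> \<open>Near 0 the factor is at most 1, and at infinity it is at most (u^2)^(-3/4) =
    u^(-3/2).\<close>
  have "(1 + u\<^sup>2) powr (-3/4) \<le> u powr (-1/2)" if "0 < u" "u \<le> 1" for u :: real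
  proof -
    have "(1 + u\<^sup>2) powr (-3/4) \<le> 1 powr (-3/4)" by (intro powr_mono2') auto
    also have "\<dots> = 1 powr (-1/2)" by simp
    also have "\<dots> \<le> u powr (-1/2)" using that by (intro powr_mono2') auto
    finally show ?thesis .
  qed
  moreover have "(1 + u\<^sup>2) powr (-3/4) \<le> u powr (-3/2)" if "1 \<le> u" for u :: real
  proof -
    have "(1 + u\<^sup>2) powr (-3/4) \<le> (u\<^sup>2) powr (-3/4)" using that by (intro powr_mono2') auto
    also have "\<dots> = u powr (-3/2)" using that by (simp add: powr_powr flip: powr_numeral)
    finally show ?thesis .
  qed
  ultimately have "(\<integral>\<^sup>+u. Z u * indicator {0<..} u \<partial>lborel) < \<infinity>"
    unfolding Z_def by (intro nn_integral_lborel_le_powr) auto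
  then have Z: "(\<integral>\<^sup>+u. Z u \<partial>lborel) < \<infinity>"
    by (subst nn_integral_lborel_even) (auto simp: Z_def ennreal_mult_less_top)
  \<comment> \<open>Near 0 the second factor is at most 1; for t >= 1 the bound t <= 1 + t^2
    supplies the missing power t^-1.\<close>
  have "t powr (-1/2) * (1 + t\<^sup>2) powr (-1) \<le> t powr (-1/2)" for t :: real
  proof -
    have "(1 + t\<^sup>2) powr (-1) \<le> 1 powr (-1)" by (intro powr_mono2') auto
    from mult_left_mono[OF this, of "t powr (-1/2)"] show ?thesis by simp
  qed
  moreover have "t powr (-1/2) * (1 + t\<^sup>2) powr (-1) \<le> t powr (-3/2)" if "1 \<le> t" for t :: real
  proof -
    have "t * 1 \<le> t * t" using that by (intro mult_left_mono) auto
    then have "t \<le> 1 + t\<^sup>2" by (simp add: power2_eq_square)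
    then have "(1 + t\<^sup>2) powr (-1) \<le> t powr (-1)"
      using that by (intro powr_mono2') auto
    then have "t powr (-1/2) * (1 + t\<^sup>2) powr (-1) \<le> t powr (-1/2) * t powr (-1)"
      by (intro mult_left_mono) auto
    also have "\<dots> = t powr (-3/2)" by (simp only: powr_add[symmetric]) simp
    finally show ?thesis .
  qed
  ultimately have T: "(\<integral>\<^sup>+t. T t \<partial>lborel) < \<infinity>"
    unfolding T_def by (intro nn_integral_lborel_le_powr) auto
  have "(\<integral>\<^sup>+x. ennreal (hkernel 0 (hdist x (0, 1)) ^ 3) \<partial>hvol)
      = (\<integral>\<^sup>+x. ennreal (1 / snd x ^ 3) * ennreal (hkernel 0 (hdist x (0, 1)) ^ 3)
            * indicator hspace x \<partial>lborel)"
    by (intro nn_integral_hvol) measurable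
  also have "\<dots> \<le> (\<integral>\<^sup>+x. ennreal (432 * 2 powr (5/2)) * (\<Prod>b\<in>Basis. F b (x \<bullet> b)) \<partial>lborel)"
  proof (rule nn_integral_mono)
    fix x :: "complex \<times> real"
    obtain z t where x: "x = (z, t)" by (cases x)
    show "ennreal (1 / snd x ^ 3) * ennreal (hkernel 0 (hdist x (0, 1)) ^ 3) * indicator hspace x
      \<le> ennreal (432 * 2 powr (5/2)) * (\<Prod>b\<in>Basis. F b (x \<bullet> b))"
    proof (cases "t > 0")
      case False
      then show ?thesis by (simp add: x hspace_def)
    next
      case True
      then have xH: "x \<in> hspace" "(0, 1) \<in> hspace" by (auto simp: x hspace_def)
      have "ennreal (1 / snd x ^ 3) * ennreal (hkernel 0 (hdist x (0, 1)) ^ 3)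
          = ennreal (1 / t ^ 3 * hkernel 0 (hdist (z, t) (0, 1)) ^ 3)"
        using True by (subst ennreal_mult') (auto simp: x)
      also have "\<dots> \<le> ennreal (432 * 2 powr (5/2) * ((1 + (Re z)\<^sup>2) powr (-3/4)
          * (1 + (Im z)\<^sup>2) powr (-3/4) * (t powr (-1/2) * (1 + t\<^sup>2) powr (-1))))"
        by (intro ennreal_leI hkernel_0_cube_le_product True)
      also have "\<dots> = ennreal (432 * 2 powr (5/2)) * (Z (Re z) * Z (Im z) * T t)"
        unfolding Z_def T_def using True by (subst ennreal_mult4) auto
      also have "Z (Re z) * Z (Im z) * T t = (\<Prod>b\<in>Basis. F b (x \<bullet> b))"
        by (simp add: Basis_complex_real F_def x complex_inner_i_right mult.assoc)
      finally show ?thesis using xH by simp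
    qed
  qed
  also have "\<dots> = ennreal (432 * 2 powr (5/2)) * (\<integral>\<^sup>+x. (\<Prod>b\<in>Basis. F b (x \<bullet> b)) \<partial>lborel)"
    by (intro nn_integral_cmult borel_measurable_prod_ennreal measurable_compose[OF _ FB]) simp
  also have "(\<integral>\<^sup>+x. (\<Prod>b\<in>Basis. F b (x \<bullet> b)) \<partial>lborel) = (\<Prod>b\<in>Basis. \<integral>\<^sup>+u. F b u \<partial>lborel)"
    by (rule nn_integral_lborel_prod) (use FB in auto)
  also have "ennreal (432 * 2 powr (5/2)) * \<dots> < \<infinity>"
    using Z T by (auto simp: ennreal_mult_less_top F_def Basis_complex_real)
  finally show ?thesis .
qed

definition kernel_constant :: ennreal where
  "kernel_constant = (\<integral>\<^sup>+x. ennreal (hkernel 0 (hdist x (0, 1)) ^ 3) \<partial>hvol)"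

text \<open>A similarity carries (0, 1) to the given centre, so one constant serves all centres and
  can be pulled out of outer integrals.\<close>

lemma nn_integral_hkernel_0_cube:
  assumes "y \<in> hspace"
  shows "(\<integral>\<^sup>+x. ennreal (hkernel 0 (hdist x y) ^ 3) \<partial>hvol) = kernel_constant"
proof -
  obtain b l where "l > 0" and y: "similarity b l (0, 1) = y"
    by (rule similarity_transitive[of "(0, 1)" y]) (use assms in \<open>auto simp: hspace_def\<close>)
  then show ?thesis
    using nn_integral_hvol_similarity[of "\<lambda>x. ennreal (hkernel 0 (hdist x y) ^ 3)" l b]
    by (simp add: kernel_constant_def flip: y)
qed

lemma kernel_constant_finite: "kernel_constant < \<infinity>"
  unfolding kernel_constant_def by (rule nn_integral_hkernel_0_cube_origin)

subsection \<open>Connectedness\<close>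

text \<open>Reachability in the symmetrised graph is a symmetric relation, so any two vertices are
  joined through the hub.\<close>

lemma connected_if_hub:
  assumes "h \<in> verts G" "\<And>u. u \<in> verts G \<Longrightarrow> h \<rightarrow>\<^sup>*\<^bsub>mk_symmetric G\<^esub> u"
  shows "Digraph_Component.connected G"
  unfolding connected_def strongly_connected_def
proof (intro conjI ballI)
  fix u v assume "u \<in> verts (mk_symmetric G)" "v \<in> verts (mk_symmetric G)"
  then have "h \<rightarrow>\<^sup>*\<^bsub>mk_symmetric G\<^esub> u" "h \<rightarrow>\<^sup>*\<^bsub>mk_symmetric G\<^esub> v" using assms(2) by auto
  then show "u \<rightarrow>\<^sup>*\<^bsub>mk_symmetric G\<^esub> v"
    by (meson symmetric_reachable symmetric_mk_symmetric rtrancl_on_trans reachable_def)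
qed (use assms(1) in auto)

text \<open>Walks are transported step by step: each arc keeps its name while \<open>f\<close> moves
  its ends, whichever way it is traversed. The identity handles enlargements of a graph, and the
  gluing map handles the second half of a join.\<close>

lemma reachable_mk_symmetric_hom:
  assumes "u \<rightarrow>\<^sup>*\<^bsub>mk_symmetric G\<^esub> v"
    and verts: "\<And>x. x \<in> verts G \<Longrightarrow> f x \<in> verts G'"
    and arcs: "\<And>e. e \<in> arcs G \<Longrightarrow> e \<in> arcs G' \<and> tail G' e = f (tail G e) \<and> head G' e = f (head G e)"
  shows "f u \<rightarrow>\<^sup>*\<^bsub>mk_symmetric G'\<^esub> f v"
  using assms(1) unfolding reachable_def
proof (induction rule: rtrancl_on.induct)
  case (rtrancl_on_refl a)
  then show ?case using verts by simp
next
  case (rtrancl_on_into_rtrancl_on a b c)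
  then have "(b, c) \<in> parcs (mk_symmetric G)" by simp
  then obtain e where "e \<in> arcs G" "b = tail G e \<and> c = head G e \<or> b = head G e \<and> c = tail G e"
    by (auto simp: parcs_mk_symmetric)
  with arcs[of e] have "(f b, f c) \<in> parcs (mk_symmetric G')"
    by (auto simp: parcs_mk_symmetric intro!: bexI[of _ e])
  then show ?case
    using rtrancl_on_into_rtrancl_on verts by (auto intro: rtrancl_on.rtrancl_on_into_rtrancl_on)
qed

lemma connected_reachable:
  assumes "Digraph_Component.connected G" "u \<in> verts G" "v \<in> verts G"
  shows "u \<rightarrow>\<^sup>*\<^bsub>mk_symmetric G\<^esub> v"
  using assms by (auto simp: connected_def strongly_connected_def)

lemma fin_conn_graphD:
  assumes "fin_conn_graph G"
  shows "wf_digraph G" "finite (verts G)" "finite (arcs G)" "verts G \<noteq> {}"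
    "\<And>e. e \<in> arcs G \<Longrightarrow> tail G e \<in> verts G" "\<And>e. e \<in> arcs G \<Longrightarrow> head G e \<in> verts G"
    "Digraph_Component.connected G"
proof -
  interpret fin_digraph G using assms by (simp add: fin_conn_graph_def)
  show "wf_digraph G" "finite (verts G)" "finite (arcs G)"
    "\<And>e. e \<in> arcs G \<Longrightarrow> tail G e \<in> verts G" "\<And>e. e \<in> arcs G \<Longrightarrow> head G e \<in> verts G"
    by (auto intro: wf_digraph_axioms)
  show "verts G \<noteq> {}" "Digraph_Component.connected G"
    using assms by (auto simp: fin_conn_graph_def connected_def strongly_connected_def)
qed

lemma fin_conn_graphI:
  assumes "finite (verts G)" "finite (arcs G)"
    "\<And>e. e \<in> arcs G \<Longrightarrow> tail G e \<in> verts G \<and> head G e \<in> verts G"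
    "h \<in> verts G" "\<And>u. u \<in> verts G \<Longrightarrow> h \<rightarrow>\<^sup>*\<^bsub>mk_symmetric G\<^esub> u"
  shows "fin_conn_graph G"
  unfolding fin_conn_graph_def using assms
  by (auto intro!: connected_if_hub[of h] simp: fin_digraph_def fin_digraph_axioms_def wf_digraph_def)

subsection \<open>Independence of the base point\<close>

text \<open>The absolute values are multiplied in \<open>ennreal\<close>, so that products over edge
  sets split and pass through integrals without integrability conditions.\<close>

definition weight ::
  "('a, 'b) pre_digraph \<Rightarrow> ('b \<Rightarrow> real) \<Rightarrow> ('a \<Rightarrow> complex \<times> real) \<Rightarrow> ennreal" where
  "weight G p x = (\<Prod>e\<in>arcs G. ennreal \<bar>hkernel (p e) (hdist (x (tail G e)) (x (head G e)))\<bar>)"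

abbreviation hpi :: "'a set \<Rightarrow> ('a \<Rightarrow> complex \<times> real) measure" where
  "hpi V \<equiv> (\<Pi>\<^sub>M v\<in>V. hvol)"

lemma network_integral_weight:
  "network_integral G p w a = (\<integral>\<^sup>+x. weight G p (x(w := a)) \<partial>hpi (verts G - {w}))"
  by (simp add: network_integral_def weight_def abs_prod prod_ennreal)

lemma in_space_hpi: "x \<in> space (hpi V) \<Longrightarrow> v \<in> V \<Longrightarrow> x v \<in> hspace"
  by (auto simp: space_PiM)

text \<open>All edges end in \<open>verts G\<close>, so updates of a configuration elsewhere can be
  discarded; this is how a vertex outside \<open>G\<close> drops out of its weight.\<close>

lemma weight_cong:
  assumes "wf_digraph G" "\<And>v. v \<in> verts G \<Longrightarrow> x v = y v"
  shows "weight G p x = weight G p y"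
  unfolding weight_def
  using assms by (intro prod.cong) (auto simp: wf_digraph_def)

lemma component_measurable:
  assumes "v \<in> V"
  shows "(\<lambda>x. x v) \<in> borel_measurable (hpi V)"
  using measurable_compose[OF measurable_component_singleton[OF assms] measurable_hvol_borel[of "\<lambda>x. x"]]
  by simp

lemma weight_measurable:
  assumes "wf_digraph G" "verts G \<subseteq> V"
  shows "weight G p \<in> borel_measurable (hpi V)"
proof -
  have "(\<lambda>x. ennreal \<bar>hkernel (p e) (hdist (x (tail G e)) (x (head G e)))\<bar>) \<in> borel_measurable (hpi V)"
    if "e \<in> arcs G" for e
  proof -
    have "tail G e \<in> V" "head G e \<in> V" using that assms by (auto simp: wf_digraph_def)
    note [measurable] = this[THEN component_measurable]
    show ?thesis by measurable
  qed
  then show ?thesis unfolding weight_def by (intro borel_measurable_prod_ennreal) auto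
qed

text \<open>Fixing the base vertex is pairing with the constant \<open>a\<close>, followed by the
  measurable map that adds a coordinate.\<close>

lemma measurable_hpi_upd:
  assumes f: "f \<in> borel_measurable (hpi (insert w V))" and a: "a \<in> hspace"
  shows "(\<lambda>x. f (x(w := a))) \<in> borel_measurable (hpi V)"
proof -
  have "(\<lambda>x. (x, a)) \<in> measurable (hpi V) (hpi V \<Otimes>\<^sub>M hvol)"
    using a by (intro measurable_Pair measurable_ident_sets[OF refl] measurable_const) auto
  from measurable_compose[OF this measurable_add_dim]
  have "(\<lambda>x. x(w := a)) \<in> measurable (hpi V) (hpi (insert w V))" by simp
  from measurable_compose[OF this f] show ?thesis .
qed

lemma similarity_hpi_measurable:
  assumes "l > 0"
  shows "(\<lambda>x. \<lambda>v\<in>V. similarity b l (x v)) \<in> measurable (hpi V) (hpi V)"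
proof (rule measurable_restrict)
  fix v assume "v \<in> V"
  then have "(\<lambda>x. x v) \<in> measurable (hpi V) hvol" by (rule measurable_component_singleton)
  from measurable_compose[OF this similarity_measurable_hvol[OF assms]]
  show "(\<lambda>x. similarity b l (x v)) \<in> measurable (hpi V) hvol" .
qed

text \<open>The product measure is determined by its values on boxes; the preimage of a box is the
  box of the preimages, and each side keeps its volume.\<close>

lemma distr_hpi_similarity:
  fixes V :: "'a set"
  assumes l: "l > 0" and V: "finite V"
  shows "distr (hpi V) (hpi V) (\<lambda>x. \<lambda>v\<in>V. similarity b l (x v)) = hpi V"
proof (rule hvol.PiM_eqI)
  note [measurable] = similarity_measurable_hvol[OF l]
  have T: "(\<lambda>x. \<lambda>v\<in>V. similarity b l (x v)) \<in> measurable (hpi V) (hpi V)"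
    by (rule similarity_hpi_measurable[OF l])
  fix A :: "'a \<Rightarrow> _" assume A: "\<And>v. v \<in> V \<Longrightarrow> A v \<in> sets hvol"
  have pre: "similarity b l -` A v \<inter> hspace \<in> sets hvol" if "v \<in> V" for v
    using measurable_sets[OF similarity_measurable_hvol[OF l] A[OF that]] by simp
  have "emeasure (distr (hpi V) (hpi V) (\<lambda>x. \<lambda>v\<in>V. similarity b l (x v))) (Pi\<^sub>E V A)
      = emeasure (hpi V) ((\<lambda>x. \<lambda>v\<in>V. similarity b l (x v)) -` Pi\<^sub>E V A \<inter> space (hpi V))"
    using A V T by (intro emeasure_distr) auto
  also have "(\<lambda>x. \<lambda>v\<in>V. similarity b l (x v)) -` Pi\<^sub>E V A \<inter> space (hpi V)
      = Pi\<^sub>E V (\<lambda>v. similarity b l -` A v \<inter> hspace)"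
    by (auto simp: space_PiM PiE_iff)
  also have "emeasure (hpi V) \<dots> = (\<Prod>v\<in>V. emeasure hvol (similarity b l -` A v \<inter> hspace))"
    using pre by (intro hvol.emeasure_PiM V)
  also have "\<dots> = (\<Prod>v\<in>V. emeasure hvol (A v))"
  proof (rule prod.cong[OF refl])
    fix v assume "v \<in> V"
    then show "emeasure hvol (similarity b l -` A v \<inter> hspace) = emeasure hvol (A v)"
      using emeasure_distr[OF similarity_measurable_hvol[OF l] A, of v b] distr_hvol_similarity[OF l, of b]
      by simp
  qed
  finally show "emeasure (distr (hpi V) (hpi V) (\<lambda>x. \<lambda>v\<in>V. similarity b l (x v))) (Pi\<^sub>E V A)
      = (\<Prod>v\<in>V. emeasure hvol (A v))" .
qed (use V in auto)

text \<open>Moving all vertices at once by a similarity that takes \<open>a\<close> to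
  \<open>c\<close> preserves the product measure and the length of every edge.\<close>

lemma network_integral_base_point:
  assumes G: "fin_conn_graph G" and w: "w \<in> verts G" and a: "a \<in> hspace" and c: "c \<in> hspace"
  shows "network_integral G p w a = network_integral G p w c"
proof -
  note fin_conn_graphD(1,2)[OF G]
  obtain b l where l: "l > 0" and ac: "similarity b l a = c"
    using a c by (rule similarity_transitive)
  let ?V = "verts G - {w}" and ?T = "\<lambda>x. \<lambda>v\<in>verts G - {w}. similarity b l (x v)"
  have T: "?T \<in> measurable (hpi ?V) (hpi ?V)"
    by (rule similarity_hpi_measurable[OF l])
  have meas: "(\<lambda>x. weight G p (x(w := c))) \<in> borel_measurable (hpi ?V)"
    by (intro measurable_hpi_upd weight_measurable fin_conn_graphD[OF G] c) auto
  have "network_integral G p w c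
      = (\<integral>\<^sup>+x. weight G p (x(w := c)) \<partial>distr (hpi ?V) (hpi ?V) ?T)"
    using distr_hpi_similarity[OF l, of ?V b] \<open>finite (verts G)\<close>
    by (simp add: network_integral_weight)
  also have "\<dots> = (\<integral>\<^sup>+x. weight G p ((?T x)(w := c)) \<partial>hpi ?V)"
    using T meas by (intro nn_integral_distr) auto
  also have "\<dots> = (\<integral>\<^sup>+x. weight G p (x(w := a)) \<partial>hpi ?V)"
  proof (rule nn_integral_cong)
    fix x
    \<comment> \<open>\<open>?T x\<close> is undefined at \<open>w\<close>, but there the update
      supplies \<open>c\<close>, which is the image of \<open>a\<close>.\<close>
    have "weight G p ((?T x)(w := c)) = weight G p (\<lambda>v. similarity b l ((x(w := a)) v))"
      using ac by (intro weight_cong fin_conn_graphD[OF G]) auto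
    also have "\<dots> = weight G p (x(w := a))"
      unfolding weight_def using l by simp
    finally show "weight G p ((?T x)(w := c)) = weight G p (x(w := a))" .
  qed
  finally show ?thesis by (simp add: network_integral_weight)
qed

subsection \<open>Adding edges and vertices\<close>

lemma weight_keeps_edges:
  assumes "keeps_edges G G'" "finite (arcs G')"
  shows "weight G' p x = weight G p x *
    (\<Prod>e\<in>arcs G' - arcs G. ennreal \<bar>hkernel (p e) (hdist (x (tail G' e)) (x (head G' e)))\<bar>)"
proof -
  have *: "weight G p x
      = (\<Prod>e\<in>arcs G. ennreal \<bar>hkernel (p e) (hdist (x (tail G' e)) (x (head G' e)))\<bar>)"
    unfolding weight_def using assms(1) by (intro prod.cong) (auto simp: keeps_edges_def)
  show ?thesis
    unfolding * unfolding weight_def using assms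
    by (subst prod.subset_diff[of "arcs G"]) (auto simp: keeps_edges_def mult.commute)
qed

text \<open>With m the largest factor, the product is at most m^card S <= m^3. Passing from m^3 to
  the sum of all cubes removes the dependence on which edge attains the maximum, so each summand
  involves a single edge and can be integrated separately.\<close>

lemma prod_le_sum_cubes:
  fixes f :: "'a \<Rightarrow> real"
  assumes S: "card S \<ge> 3" and f: "\<And>e. e \<in> S \<Longrightarrow> 0 \<le> f e \<and> f e \<le> 1"
  shows "(\<Prod>e\<in>S. f e) \<le> (\<Sum>e\<in>S. f e ^ 3)"
proof -
  have fin: "finite S" and ne: "S \<noteq> {}" using S by (auto intro: card_ge_0_finite)
  define m where "m = Max (f ` S)"
  have "m \<in> f ` S" unfolding m_def using fin ne by (intro Max_in) auto
  then obtain e where e: "e \<in> S" "f e = m" by auto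
  have "(\<Prod>e\<in>S. f e) \<le> (\<Prod>e\<in>S. m)"
    using f fin by (intro prod_mono) (auto simp: m_def)
  also have "\<dots> = m ^ card S" by simp
  also have "\<dots> \<le> m ^ 3" using S e f[of e] by (intro power_decreasing) auto
  also have "\<dots> = (\<Sum>e\<in>{e}. f e ^ 3)" using e by simp
  also have "\<dots> \<le> (\<Sum>e\<in>S. f e ^ 3)" using e f fin by (intro sum_mono2) auto
  finally show ?thesis .
qed

text \<open>Both graphs have the same domain of integration, and the integrand only decreases: at
  points of hyperbolic space each extra factor lies in [0, 1].\<close>

lemma integrable_network_adds_edges:
  assumes G: "fin_conn_graph G" and G': "fin_conn_graph G'" and A: "adds_edges G G'"
    and I: "integrable_network G p"
  shows "integrable_network G' p"
  unfolding integrable_network_def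
proof (intro ballI)
  fix w a assume w: "w \<in> verts G'" and a: "a \<in> hspace"
  have V: "verts G' = verts G" and K: "keeps_edges G G'" using A by (auto simp: adds_edges_def)
  have "network_integral G' p w a \<le> network_integral G p w a"
    unfolding network_integral_weight V
  proof (rule nn_integral_mono)
    fix x assume x: "x \<in> space (hpi (verts G - {w}))"
    let ?x = "x(w := a)"
    have H: "?x u \<in> hspace" if "u \<in> verts G" for u
      using in_space_hpi[OF x, of u] a that by auto
    define k where "k e = \<bar>hkernel (p e) (hdist (?x (tail G' e)) (?x (head G' e)))\<bar>" for e
    have k: "0 \<le> k e \<and> k e \<le> 1" if "e \<in> arcs G' - arcs G" for e
      using that fin_conn_graphD(5,6)[OF G', of e] V
      unfolding k_def by (intro conjI abs_ge_zero abs_hkernel_le_1 hdist_nonneg H) auto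
    have "(\<Prod>e\<in>arcs G' - arcs G. ennreal (k e)) = ennreal (\<Prod>e\<in>arcs G' - arcs G. k e)"
      using k by (intro prod_ennreal) auto
    also have "\<dots> \<le> 1" using k by (simp only: ennreal_le_1) (rule prod_le_1)
    finally have "(\<Prod>e\<in>arcs G' - arcs G. ennreal (k e)) \<le> 1" .
    from mult_left_mono[OF this zero_le, of "weight G p ?x"]
    show "weight G' p ?x \<le> weight G p ?x"
      by (simp add: weight_keeps_edges[OF K fin_conn_graphD(3)[OF G']] k_def)
  qed
  also have "\<dots> < \<infinity>" using I w a V by (auto simp: integrable_network_def)
  finally show "network_integral G' p w a < \<infinity>" .
qed

text \<open>A label-free majorant for the cube of the factor of one new edge, valued in
  \<open>ennreal\<close> to match \<open>weight\<close>.\<close>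

definition cube_bound :: "complex \<times> real \<Rightarrow> complex \<times> real \<Rightarrow> ennreal" where
  "cube_bound x y = ennreal (hkernel 0 (hdist x y) ^ 3)"

lemma cube_bound_sym: "cube_bound x y = cube_bound y x"
  by (simp add: cube_bound_def hdist_sym)

lemma cube_bound_measurable [measurable]:
  assumes [measurable]: "f \<in> borel_measurable M" "g \<in> borel_measurable M"
  shows "(\<lambda>x. cube_bound (f x) (g x)) \<in> borel_measurable M"
  unfolding cube_bound_def by measurable

lemma nn_integral_cube_bound:
  "y \<in> hspace \<Longrightarrow> (\<integral>\<^sup>+x. cube_bound x y \<partial>hvol) = kernel_constant"
  unfolding cube_bound_def by (rule nn_integral_hkernel_0_cube)

lemma cube_bound_measurable_hvol: "(\<lambda>x. cube_bound x y) \<in> borel_measurable hvol"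
  by (rule measurable_hvol_borel) measurable

text \<open>If the new vertex \<open>v\<close> is itself the base vertex, the roles of \<open>v\<close> and \<open>u\<close> are exchanged: with \<open>u\<close> as
  base vertex of \<open>G\<close>, the integral over its position is the integral of the cubed kernel.\<close>

lemma nn_integral_weight_cube_bound:
  fixes G :: "('a, 'b) pre_digraph"
  assumes G: "fin_conn_graph G" and I: "integrable_network G p"
    and v: "v \<notin> verts G" and u: "u \<in> verts G" and w: "w \<in> insert v (verts G)" and a: "a \<in> hspace"
  defines "f \<equiv> \<lambda>z. weight G p z * cube_bound (z v) (z u)"
  shows "(\<integral>\<^sup>+x. f (x(w := a)) \<partial>hpi (insert v (verts G) - {w})) < \<infinity>"
proof -
  note wf = fin_conn_graphD(1)[OF G] and fin = fin_conn_graphD(2)[OF G]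
  have f_meas: "f \<in> borel_measurable (hpi (insert v (verts G)))"
    unfolding f_def using u wf
    by (intro borel_measurable_times_ennreal weight_measurable cube_bound_measurable
        component_measurable) auto
  have V: "insert w (insert v (verts G) - {w}) = insert v (verts G)" using w by auto
  have meas: "(\<lambda>x. f (x(w := a))) \<in> borel_measurable (hpi (insert v (verts G) - {w}))"
    using measurable_hpi_upd[of f w "insert v (verts G) - {w}" a] f_meas a unfolding V by blast
  show ?thesis
  proof (cases "w = v")
    case False
    then have w': "w \<in> verts G" using w by auto
    then have V': "insert v (verts G) - {w} = insert v (verts G - {w})" using False by auto
    have "(\<integral>\<^sup>+x. f (x(w := a)) \<partial>hpi (insert v (verts G) - {w}))
        = (\<integral>\<^sup>+x. (\<integral>\<^sup>+y. f (x(v := y, w := a)) \<partial>hvol) \<partial>hpi (verts G - {w}))"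
      unfolding V' using v fin meas by (intro hvol.product_nn_integral_insert) (auto simp: V')
    \<comment> \<open>Only the cubed kernel depends on the position of \<open>v\<close>, and its
      integral is the same for every position of \<open>u\<close>.\<close>
    also have "\<dots> = (\<integral>\<^sup>+x. weight G p (x(w := a)) * kernel_constant \<partial>hpi (verts G - {w}))"
    proof (rule nn_integral_cong)
      fix x assume x: "x \<in> space (hpi (verts G - {w}))"
      have H: "(x(w := a)) u \<in> hspace"
        using in_space_hpi[OF x, of u] a u by auto
      have "(\<integral>\<^sup>+y. f (x(v := y, w := a)) \<partial>hvol)
          = (\<integral>\<^sup>+y. weight G p (x(w := a)) * cube_bound y ((x(w := a)) u) \<partial>hvol)"
      proof (rule nn_integral_cong)
        fix y
        have "weight G p (x(v := y, w := a)) = weight G p (x(w := a))"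
          using v by (intro weight_cong wf) auto
        then show "f (x(v := y, w := a)) = weight G p (x(w := a)) * cube_bound y ((x(w := a)) u)"
          using False u v by (auto simp: f_def)
      qed
      also have "\<dots> = weight G p (x(w := a)) * kernel_constant"
        by (subst nn_integral_cmult) (simp_all only: cube_bound_measurable_hvol nn_integral_cube_bound[OF H])
      finally show "(\<integral>\<^sup>+y. f (x(v := y, w := a)) \<partial>hvol) = weight G p (x(w := a)) * kernel_constant" .
    qed
    also have "\<dots> = network_integral G p w a * kernel_constant"
      unfolding network_integral_weight
      by (intro nn_integral_multc measurable_hpi_upd weight_measurable wf a) auto
    also have "\<dots> < \<infinity>"
      using I w' a kernel_constant_finite by (auto simp: integrable_network_def ennreal_mult_less_top)
    finally show ?thesis .
  next
    case True
    have V': "insert v (verts G) - {w} = insert u (verts G - {u})" using True v u by auto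
    have "(\<integral>\<^sup>+x. f (x(w := a)) \<partial>hpi (insert v (verts G) - {w}))
        = (\<integral>\<^sup>+y. (\<integral>\<^sup>+x. f (x(u := y, w := a)) \<partial>hpi (verts G - {u})) \<partial>hvol)"
      unfolding V' using fin meas by (intro hvol.product_nn_integral_insert_rev) (auto simp: V')
    also have "\<dots> = (\<integral>\<^sup>+y. network_integral G p u a * cube_bound y a \<partial>hvol)"
    proof (rule nn_integral_cong)
      fix y assume "y \<in> space hvol"
      then have y: "y \<in> hspace" by simp
      have "(\<integral>\<^sup>+x. f (x(u := y, w := a)) \<partial>hpi (verts G - {u}))
          = (\<integral>\<^sup>+x. weight G p (x(u := y)) * cube_bound y a \<partial>hpi (verts G - {u}))"
      proof (rule nn_integral_cong)
        fix x
        have "weight G p (x(u := y, w := a)) = weight G p (x(u := y))"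
          using True v by (intro weight_cong wf) auto
        then show "f (x(u := y, w := a)) = weight G p (x(u := y)) * cube_bound y a"
          using True u v by (auto simp: f_def cube_bound_sym)
      qed
      also have "\<dots> = network_integral G p u y * cube_bound y a"
        unfolding network_integral_weight
        using y u by (intro nn_integral_multc measurable_hpi_upd weight_measurable wf) auto
      \<comment> \<open>The integral over the remaining old vertices is constant in the position of
        \<open>u\<close>, so it leaves the outer integral.\<close>
      also have "network_integral G p u y = network_integral G p u a"
        by (rule network_integral_base_point[OF G u y a])
      finally show "(\<integral>\<^sup>+x. f (x(u := y, w := a)) \<partial>hpi (verts G - {u}))
          = network_integral G p u a * cube_bound y a" .
    qed
    also have "\<dots> = network_integral G p u a * kernel_constant"
      by (subst nn_integral_cmult) (simp_all only: cube_bound_measurable_hvol nn_integral_cube_bound[OF a])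
    also have "\<dots> < \<infinity>"
      using I u a kernel_constant_finite by (auto simp: integrable_network_def ennreal_mult_less_top)
    finally show ?thesis .
  qed
qed

lemma reachable_mk_symmetric_keeps_edges:
  assumes "fin_conn_graph G" "keeps_edges G G'" "verts G \<subseteq> verts G'" "u \<in> verts G" "v \<in> verts G"
  shows "u \<rightarrow>\<^sup>*\<^bsub>mk_symmetric G'\<^esub> v"
proof (rule reachable_mk_symmetric_hom[where f = "\<lambda>x. x"])
  show "u \<rightarrow>\<^sup>*\<^bsub>mk_symmetric G\<^esub> v"
    by (rule connected_reachable[OF fin_conn_graphD(7)[OF assms(1)] assms(4,5)])
qed (use assms(2,3) in \<open>auto simp: keeps_edges_def\<close>)

lemma fin_conn_graph_adds_edges:
  assumes G: "fin_conn_graph G" and A: "adds_edges G G'" and fin: "finite (arcs G' - arcs G)"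
  shows "fin_conn_graph G'"
proof -
  have K: "keeps_edges G G'" and V: "verts G' = verts G" using A by (auto simp: adds_edges_def)
  have arcs: "arcs G' = arcs G \<union> (arcs G' - arcs G)" using K by (auto simp: keeps_edges_def)
  obtain h where h: "h \<in> verts G" using fin_conn_graphD(4)[OF G] by auto
  show ?thesis
  proof (rule fin_conn_graphI)
    show "finite (verts G')" using fin_conn_graphD(2)[OF G] V by simp
    show "finite (arcs G')" using fin_conn_graphD(3)[OF G] fin by (subst arcs) blast
    show "tail G' e \<in> verts G' \<and> head G' e \<in> verts G'" if "e \<in> arcs G'" for e
      using that A fin_conn_graphD(5,6)[OF G, of e]
      by (cases "e \<in> arcs G") (auto simp: adds_edges_def keeps_edges_def)
    show "h \<in> verts G'" using h V by simp
    show "h \<rightarrow>\<^sup>*\<^bsub>mk_symmetric G'\<^esub> u" if "u \<in> verts G'" for u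
      using reachable_mk_symmetric_keeps_edges[OF G K] that h V by simp
  qed
qed

lemma fin_conn_graph_adds_vertex:
  assumes G: "fin_conn_graph G" and A: "adds_vertex G G'" and fin: "finite (arcs G' - arcs G)"
    and ne: "arcs G' - arcs G \<noteq> {}"
  shows "fin_conn_graph G'"
proof -
  obtain v where K: "keeps_edges G G'" and v: "v \<notin> verts G" "verts G' = insert v (verts G)"
    and new: "\<And>e. e \<in> arcs G' - arcs G \<Longrightarrow>
      (tail G' e = v \<and> head G' e \<in> verts G) \<or> (tail G' e \<in> verts G \<and> head G' e = v)"
    using A by (auto simp: adds_vertex_def)
  have arcs: "arcs G' = arcs G \<union> (arcs G' - arcs G)" using K by (auto simp: keeps_edges_def)
  obtain e where e: "e \<in> arcs G' - arcs G" using ne by auto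
  \<comment> \<open>The old endpoint of one new edge serves as hub: it reaches the old vertices
    inside \<open>G\<close>, and \<open>v\<close> along that edge.\<close>
  obtain h where h: "h \<in> verts G" "(h, v) \<in> parcs (mk_symmetric G')"
    using new[OF e] e by (auto simp: parcs_mk_symmetric)
  have old: "h \<rightarrow>\<^sup>*\<^bsub>mk_symmetric G'\<^esub> u" if "u \<in> verts G" for u
    using reachable_mk_symmetric_keeps_edges[OF G K _ h(1) that] v by auto
  have hv: "h \<rightarrow>\<^sup>*\<^bsub>mk_symmetric G'\<^esub> v"
    using rtrancl_on_into_rtrancl_on[OF old[OF h(1), unfolded reachable_def], of v] h(2) v
    by (simp add: reachable_def)
  show ?thesis
  proof (rule fin_conn_graphI)
    show "finite (verts G')" using fin_conn_graphD(2)[OF G] v by simp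
    show "finite (arcs G')" using fin_conn_graphD(3)[OF G] fin by (subst arcs) blast
    show "tail G' e \<in> verts G' \<and> head G' e \<in> verts G'" if "e \<in> arcs G'" for e
      using that K v new[of e] fin_conn_graphD(5,6)[OF G, of e]
      by (cases "e \<in> arcs G") (auto simp: keeps_edges_def)
    show "h \<in> verts G'" using h v by simp
    show "h \<rightarrow>\<^sup>*\<^bsub>mk_symmetric G'\<^esub> u" if "u \<in> verts G'" for u
      using that old hv v by auto
  qed
qed

lemma integrable_network_adds_vertex:
  assumes G: "fin_conn_graph G" and G': "fin_conn_graph G'" and A: "adds_vertex G G'"
    and card: "card (arcs G' - arcs G) \<ge> 3" and I: "integrable_network G p"
  shows "integrable_network G' p"
  unfolding integrable_network_def
proof (intro ballI)
  fix w a assume w: "w \<in> verts G'" and a: "a \<in> hspace"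
  obtain v where K: "keeps_edges G G'" and v: "v \<notin> verts G" "verts G' = insert v (verts G)"
    and new: "\<And>e. e \<in> arcs G' - arcs G \<Longrightarrow>
      (tail G' e = v \<and> head G' e \<in> verts G) \<or> (tail G' e \<in> verts G \<and> head G' e = v)"
    using A by (auto simp: adds_vertex_def)
  define D where "D = arcs G' - arcs G"
  \<comment> \<open>Orientations are arbitrary, so the old endpoint of a new edge has to be selected
    by cases.\<close>
  define u where "u e = (if tail G' e = v then head G' e else tail G' e)" for e
  have u: "u e \<in> verts G" if "e \<in> D" for e
    using new[of e] that v by (auto simp: u_def D_def)
  have finD: "finite D" using card by (auto simp: D_def intro: card_ge_0_finite)
  have wV: "w \<in> insert v (verts G)" using w v by simp
  let ?M = "hpi (insert v (verts G) - {w})"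
  define f where "f e z = weight G p z * cube_bound (z v) (z (u e))" for e and z :: "'a \<Rightarrow> complex \<times> real"
  \<comment> \<open>Each summand on the right is the weight of \<open>G\<close> with one cubed
    kernel attached at \<open>v\<close>, the situation of
    \<open>nn_integral_weight_cube_bound\<close>.\<close>
  have "network_integral G' p w a \<le> (\<integral>\<^sup>+x. (\<Sum>e\<in>D. f e (x(w := a))) \<partial>?M)"
    unfolding network_integral_weight v(2)
  proof (rule nn_integral_mono)
    fix x assume x: "x \<in> space ?M"
    let ?x = "x(w := a)"
    have H: "?x s \<in> hspace" if "s \<in> insert v (verts G)" for s
      using in_space_hpi[OF x, of s] a that by auto
    define k where "k e = \<bar>hkernel (p e) (hdist (?x (tail G' e)) (?x (head G' e)))\<bar>" for e
    have k: "0 \<le> k e" "k e \<le> 1" "k e ^ 3 \<le> hkernel 0 (hdist (?x v) (?x (u e))) ^ 3" if e: "e \<in> D" for e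
    proof -
      have vu: "hdist (?x (tail G' e)) (?x (head G' e)) = hdist (?x v) (?x (u e))"
        using new[of e] e v(1) by (auto simp: D_def u_def intro: hdist_sym)
      have n: "hdist (?x v) (?x (u e)) \<ge> 0" using u[OF e] by (intro hdist_nonneg H) auto
      show "0 \<le> k e" by (simp add: k_def)
      show "k e \<le> 1" unfolding k_def vu by (rule abs_hkernel_le_1[OF n])
      show "k e ^ 3 \<le> hkernel 0 (hdist (?x v) (?x (u e))) ^ 3"
        unfolding k_def vu by (intro power_mono abs_hkernel_le n) auto
    qed
    have "(\<Prod>e\<in>D. ennreal (k e)) = ennreal (\<Prod>e\<in>D. k e)"
      using k by (intro prod_ennreal) auto
    also have "\<dots> \<le> ennreal (\<Sum>e\<in>D. hkernel 0 (hdist (?x v) (?x (u e))) ^ 3)"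
      using prod_le_sum_cubes[of D k] card k
      by (intro ennreal_leI order_trans[OF prod_le_sum_cubes sum_mono]) (auto simp: D_def)
    also have "\<dots> = (\<Sum>e\<in>D. cube_bound (?x v) (?x (u e)))"
      unfolding cube_bound_def using k by (intro sum_ennreal[symmetric]) (meson order_trans zero_le_power)
    finally have "weight G p ?x * (\<Prod>e\<in>D. ennreal (k e))
        \<le> weight G p ?x * (\<Sum>e\<in>D. cube_bound (?x v) (?x (u e)))"
      by (intro mult_left_mono) auto
    then show "weight G' p ?x \<le> (\<Sum>e\<in>D. f e ?x)"
      by (simp add: weight_keeps_edges[OF K fin_conn_graphD(3)[OF G']] f_def k_def D_def sum_distrib_left)
  qed
  also have "\<dots> = (\<Sum>e\<in>D. \<integral>\<^sup>+x. f e (x(w := a)) \<partial>?M)"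
  proof (rule nn_integral_sum)
    fix e assume e: "e \<in> D"
    have "f e \<in> borel_measurable (hpi (insert v (verts G)))"
      unfolding f_def using u[OF e]
      by (intro borel_measurable_times_ennreal weight_measurable cube_bound_measurable
          component_measurable fin_conn_graphD(1)[OF G]) auto
    moreover have V: "insert w (insert v (verts G) - {w}) = insert v (verts G)" using wV by auto
    ultimately show "(\<lambda>x. f e (x(w := a))) \<in> borel_measurable ?M"
      using measurable_hpi_upd[of "f e" w "insert v (verts G) - {w}" a] a unfolding V by blast
  qed
  also have "\<dots> < \<infinity>"
    unfolding f_def using nn_integral_weight_cube_bound[OF G I v(1) u wV a] finD
    by simp
  finally show "network_integral G' p w a < \<infinity>" .
qed

subsection \<open>Joining two graphs at a vertex\<close>

locale disjoint_graphs =
  fixes G\<^sub>1 G\<^sub>2 :: "('a, 'b) pre_digraph" and v\<^sub>1 v\<^sub>2 :: 'a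
  assumes G1: "fin_conn_graph G\<^sub>1" and G2: "fin_conn_graph G\<^sub>2"
    and disj_verts: "verts G\<^sub>1 \<inter> verts G\<^sub>2 = {}" and disj_arcs: "arcs G\<^sub>1 \<inter> arcs G\<^sub>2 = {}"
    and v1: "v\<^sub>1 \<in> verts G\<^sub>1" and v2: "v\<^sub>2 \<in> verts G\<^sub>2"
begin

abbreviation "J \<equiv> join_at G\<^sub>1 v\<^sub>1 G\<^sub>2 v\<^sub>2"

text \<open>The \<open>let\<close>-bound map of \<open>join_at\<close>, given a name so that it can
  act as a graph homomorphism from \<open>G\<^sub>2\<close> to the join.\<close>

definition glue :: "'a \<Rightarrow> 'a" where
  "glue v = (if v = v\<^sub>2 then v\<^sub>1 else v)"

lemma verts_join: "verts J = verts G\<^sub>1 \<union> (verts G\<^sub>2 - {v\<^sub>2})"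
  using v1 v2 by (auto simp: join_at_def Let_def)

lemma arcs_join: "arcs J = arcs G\<^sub>1 \<union> arcs G\<^sub>2"
  by (simp add: join_at_def Let_def)

lemma ends_join_1:
  assumes "e \<in> arcs G\<^sub>1"
  shows "tail J e = tail G\<^sub>1 e" "head J e = head G\<^sub>1 e"
  using assms by (auto simp: join_at_def Let_def)

lemma ends_join_2:
  assumes "e \<in> arcs G\<^sub>2"
  shows "tail J e = glue (tail G\<^sub>2 e)" "head J e = glue (head G\<^sub>2 e)"
  using assms disj_arcs by (auto simp: join_at_def Let_def glue_def)

lemma glue_in: "v \<in> verts G\<^sub>2 \<Longrightarrow> glue v \<in> verts J"
  using v1 by (auto simp: verts_join glue_def)

text \<open>The common vertex is a hub: walks in \<open>G\<^sub>1\<close> are included unchanged,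
  and walks in \<open>G\<^sub>2\<close> from \<open>v\<^sub>2\<close> are mapped by
  \<open>glue\<close> to walks from \<open>v\<^sub>1\<close>.\<close>

lemma fin_conn_graph_join: "fin_conn_graph J"
proof (rule fin_conn_graphI)
  show "finite (verts J)" "finite (arcs J)"
    using fin_conn_graphD(2,3)[OF G1] fin_conn_graphD(2,3)[OF G2] by (auto simp: verts_join arcs_join)
  show "tail J e \<in> verts J \<and> head J e \<in> verts J" if "e \<in> arcs J" for e
  proof (cases "e \<in> arcs G\<^sub>1")
    case True
    then show ?thesis using fin_conn_graphD(5,6)[OF G1] by (auto simp: ends_join_1 verts_join)
  next
    case False
    then have "e \<in> arcs G\<^sub>2" using that by (simp add: arcs_join)
    then show ?thesis using fin_conn_graphD(5,6)[OF G2] glue_in by (auto simp: ends_join_2)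
  qed
  show "v\<^sub>1 \<in> verts J" using v1 by (simp add: verts_join)
  show "v\<^sub>1 \<rightarrow>\<^sup>*\<^bsub>mk_symmetric J\<^esub> u" if "u \<in> verts J" for u
  proof (cases "u \<in> verts G\<^sub>1")
    case True
    then show ?thesis
      by (intro reachable_mk_symmetric_hom[OF connected_reachable[OF fin_conn_graphD(7)[OF G1] v1 True],
            where f = "\<lambda>x. x"])
         (simp_all add: ends_join_1 arcs_join verts_join)
  next
    case False
    then have u: "u \<in> verts G\<^sub>2" "u \<noteq> v\<^sub>2" using that by (auto simp: verts_join)
    have "glue v\<^sub>2 \<rightarrow>\<^sup>*\<^bsub>mk_symmetric J\<^esub> glue u"
      by (intro reachable_mk_symmetric_hom[OF connected_reachable[OF fin_conn_graphD(7)[OF G2] v2 u(1)]]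
            glue_in) (simp_all add: ends_join_2 arcs_join)
    then show ?thesis using u by (simp add: glue_def)
  qed
qed

text \<open>The edges form a disjoint union, and reading positions at glued endpoints amounts to
  giving \<open>v\<^sub>2\<close> the position of \<open>v\<^sub>1\<close>.\<close>

lemma weight_join:
  "weight J p x = weight G\<^sub>1 p x * weight G\<^sub>2 p (x(v\<^sub>2 := x v\<^sub>1))"
proof -
  have g: "(x(v\<^sub>2 := x v\<^sub>1)) v = x (glue v)" for v by (simp add: glue_def)
  show ?thesis
    unfolding weight_def arcs_join g
    by (subst prod.union_disjoint)
       (auto simp: disj_arcs fin_conn_graphD(3)[OF G1] fin_conn_graphD(3)[OF G2] ends_join_1 ends_join_2
         intro!: arg_cong2[of _ _ _ _ "(*)"] prod.cong)
qed

text \<open>The vertices of \<open>G\<^sub>2\<close> other than \<open>v\<^sub>2\<close> are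
  integrated first. This gives the integral of \<open>G\<^sub>2\<close> with
  \<open>v\<^sub>2\<close> placed at the position of \<open>v\<^sub>1\<close>, which is constant by
  base point invariance and factors out.\<close>

lemma network_integral_join_1:
  assumes w: "w \<in> verts G\<^sub>1" and a: "a \<in> hspace"
  shows "network_integral J p w a = network_integral G\<^sub>1 p w a * network_integral G\<^sub>2 p v\<^sub>2 a"
proof -
  let ?A = "verts G\<^sub>1 - {w}" and ?B = "verts G\<^sub>2 - {v\<^sub>2}"
  have V: "verts J - {w} = ?A \<union> ?B" using w disj_verts by (auto simp: verts_join)
  have iV: "insert w (?A \<union> ?B) = verts J" using w by (auto simp: verts_join)
  note wf1 = fin_conn_graphD(1)[OF G1] and wf2 = fin_conn_graphD(1)[OF G2]
  have "network_integral J p w a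
      = (\<integral>\<^sup>+x. (\<integral>\<^sup>+y. weight J p ((merge ?A ?B (x, y))(w := a)) \<partial>hpi ?B) \<partial>hpi ?A)"
    unfolding network_integral_weight V
    using disj_verts fin_conn_graphD(2)[OF G1] fin_conn_graphD(2)[OF G2]
    by (intro hvol.product_nn_integral_fold measurable_hpi_upd a)
       (auto simp: iV intro!: weight_measurable fin_conn_graphD(1)[OF fin_conn_graph_join])
  also have "\<dots> = (\<integral>\<^sup>+x. weight G\<^sub>1 p (x(w := a)) * network_integral G\<^sub>2 p v\<^sub>2 a \<partial>hpi ?A)"
  proof (rule nn_integral_cong)
    fix x assume x: "x \<in> space (hpi ?A)"
    \<comment> \<open>\<open>c\<close> is the position of the common vertex: a variable, or
      \<open>a\<close> itself when \<open>w\<close> is \<open>v\<^sub>1\<close>.\<close>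
    define c where "c = (x(w := a)) v\<^sub>1"
    have c: "c \<in> hspace" using in_space_hpi[OF x, of v\<^sub>1] v1 a by (auto simp: c_def)
    have "weight J p ((merge ?A ?B (x, y))(w := a)) = weight G\<^sub>1 p (x(w := a)) * weight G\<^sub>2 p (y(v\<^sub>2 := c))" for y
      unfolding weight_join
      using disj_verts w v1
      by (intro arg_cong2[of _ _ _ _ "(*)"] weight_cong wf1 wf2) (auto simp: c_def merge_def)
    then have "(\<integral>\<^sup>+y. weight J p ((merge ?A ?B (x, y))(w := a)) \<partial>hpi ?B)
        = weight G\<^sub>1 p (x(w := a)) * network_integral G\<^sub>2 p v\<^sub>2 c"
      unfolding network_integral_weight using c
      by (simp, intro nn_integral_cmult measurable_hpi_upd weight_measurable wf2) auto
    then show "(\<integral>\<^sup>+y. weight J p ((merge ?A ?B (x, y))(w := a)) \<partial>hpi ?B)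
        = weight G\<^sub>1 p (x(w := a)) * network_integral G\<^sub>2 p v\<^sub>2 a"
      by (simp add: network_integral_base_point[OF G2 v2 c a])
  qed
  also have "\<dots> = network_integral G\<^sub>1 p w a * network_integral G\<^sub>2 p v\<^sub>2 a"
    unfolding network_integral_weight[of G\<^sub>1]
    by (intro nn_integral_multc measurable_hpi_upd weight_measurable wf1 a) auto
  finally show ?thesis .
qed

text \<open>With the base vertex in the second graph the order is reversed: \<open>G\<^sub>1\<close>
  is integrated first, based at the common vertex, whose position remains an outer variable.\<close>

lemma network_integral_join_2:
  assumes w: "w \<in> verts G\<^sub>2" "w \<noteq> v\<^sub>2" and a: "a \<in> hspace"
  shows "network_integral J p w a = network_integral G\<^sub>1 p v\<^sub>1 a * network_integral G\<^sub>2 p w a"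
proof -
  let ?B = "verts G\<^sub>1 - {v\<^sub>1}" and ?C = "verts G\<^sub>2 - {v\<^sub>2, w}"
  \<comment> \<open>These are the variables of \<open>G\<^sub>2\<close>, with the common vertex
    under its name \<open>v\<^sub>1\<close> in the join.\<close>
  let ?A = "insert v\<^sub>1 ?C"
  have V: "verts J - {w} = ?A \<union> ?B" using w v1 disj_verts by (auto simp: verts_join)
  have iV: "insert w (?A \<union> ?B) = verts J" using w v1 disj_verts by (auto simp: verts_join)
  have v1': "v\<^sub>1 \<notin> verts G\<^sub>2" and w1: "w \<notin> verts G\<^sub>1" "w \<noteq> v\<^sub>1" "v\<^sub>2 \<noteq> v\<^sub>1"
    using v1 v2 w disj_verts by auto
  note wf1 = fin_conn_graphD(1)[OF G1] and wf2 = fin_conn_graphD(1)[OF G2]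
  note fin1 = fin_conn_graphD(2)[OF G1] and fin2 = fin_conn_graphD(2)[OF G2]
  have iC: "insert w (insert v\<^sub>2 ?C) = verts G\<^sub>2" "insert v\<^sub>2 ?C = verts G\<^sub>2 - {w}"
    using w v2 by auto
  \<comment> \<open>Here \<open>v\<^sub>2\<close> receives a coordinate of \<open>x\<close> rather
    than a constant, so measurability is checked edge by edge.\<close>
  define g where "g x = weight G\<^sub>2 p (x(w := a, v\<^sub>2 := x v\<^sub>1))" for x
  have g_meas: "g \<in> borel_measurable (hpi ?A)"
  proof -
    have "(\<lambda>x. ennreal \<bar>hkernel (p e) (hdist ((x(w := a, v\<^sub>2 := x v\<^sub>1)) (tail G\<^sub>2 e)) ((x(w := a, v\<^sub>2 := x v\<^sub>1)) (head G\<^sub>2 e)))\<bar>)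
        \<in> borel_measurable (hpi ?A)" if "e \<in> arcs G\<^sub>2" for e
    proof -
      have "(\<lambda>x. (x(w := a, v\<^sub>2 := x v\<^sub>1)) u) \<in> borel_measurable (hpi ?A)" if "u \<in> verts G\<^sub>2" for u
        using that component_measurable[of v\<^sub>1 ?A] component_measurable[of u ?A]
        by (cases "u = v\<^sub>2"; cases "u = w") auto
      note [measurable] = this[OF fin_conn_graphD(5)[OF G2 that]] this[OF fin_conn_graphD(6)[OF G2 that]]
      show ?thesis by measurable
    qed
    then show ?thesis unfolding g_def weight_def by (intro borel_measurable_prod_ennreal) auto
  qed
  have "network_integral J p w a
      = (\<integral>\<^sup>+x. (\<integral>\<^sup>+y. weight J p ((merge ?A ?B (x, y))(w := a)) \<partial>hpi ?B) \<partial>hpi ?A)"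
    unfolding network_integral_weight V
    using disj_verts fin1 fin2
    by (intro hvol.product_nn_integral_fold measurable_hpi_upd a)
       (auto simp: iV[simplified] intro!: weight_measurable fin_conn_graphD(1)[OF fin_conn_graph_join])
  also have "\<dots> = (\<integral>\<^sup>+x. network_integral G\<^sub>1 p v\<^sub>1 a * g x \<partial>hpi ?A)"
  proof (rule nn_integral_cong)
    fix x assume x: "x \<in> space (hpi ?A)"
    have c: "x v\<^sub>1 \<in> hspace" using in_space_hpi[OF x, of v\<^sub>1] by auto
    have "weight J p ((merge ?A ?B (x, y))(w := a)) = weight G\<^sub>1 p (y(v\<^sub>1 := x v\<^sub>1)) * g x" for y
      unfolding weight_join g_def
      using disj_verts v1' w1
      by (intro arg_cong2[of _ _ _ _ "(*)"] weight_cong wf1 wf2) (auto simp: merge_def)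
    then have "(\<integral>\<^sup>+y. weight J p ((merge ?A ?B (x, y))(w := a)) \<partial>hpi ?B)
        = network_integral G\<^sub>1 p v\<^sub>1 (x v\<^sub>1) * g x"
      unfolding network_integral_weight using c
      by (simp, intro nn_integral_multc measurable_hpi_upd weight_measurable wf1) auto
    then show "(\<integral>\<^sup>+y. weight J p ((merge ?A ?B (x, y))(w := a)) \<partial>hpi ?B)
        = network_integral G\<^sub>1 p v\<^sub>1 a * g x"
      by (simp add: network_integral_base_point[OF G1 v1 c a])
  qed
  also have "\<dots> = network_integral G\<^sub>1 p v\<^sub>1 a * (\<integral>\<^sup>+x. g x \<partial>hpi ?A)"
    by (rule nn_integral_cmult[OF g_meas])
  \<comment> \<open>The coordinate at \<open>v\<^sub>1\<close> is split off and then reinserted at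
    \<open>v\<^sub>2\<close>, which renames the integration variable.\<close>
  also have "(\<integral>\<^sup>+x. g x \<partial>hpi ?A) = (\<integral>\<^sup>+x. (\<integral>\<^sup>+y. g (x(v\<^sub>1 := y)) \<partial>hvol) \<partial>hpi ?C)"
    using fin2 v1' g_meas by (intro hvol.product_nn_integral_insert) auto
  also have "\<dots> = (\<integral>\<^sup>+x. (\<integral>\<^sup>+y. weight G\<^sub>2 p (x(v\<^sub>2 := y, w := a)) \<partial>hvol) \<partial>hpi ?C)"
    unfolding g_def using v1' w
    by (intro nn_integral_cong weight_cong wf2) auto
  also have "\<dots> = (\<integral>\<^sup>+x. weight G\<^sub>2 p (x(w := a)) \<partial>hpi (insert v\<^sub>2 ?C))"
    using fin2 a wf2 w v2
    by (intro hvol.product_nn_integral_insert[symmetric] measurable_hpi_upd weight_measurable) auto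
  also have "\<dots> = network_integral G\<^sub>2 p w a"
    by (simp only: iC network_integral_weight)
  finally show ?thesis .
qed

lemma integrable_network_join:
  assumes "integrable_network G\<^sub>1 p" "integrable_network G\<^sub>2 p"
  shows "integrable_network J p"
  unfolding integrable_network_def
proof (intro ballI)
  fix w a assume w: "w \<in> verts J" and a: "a \<in> hspace"
  \<comment> \<open>As \<open>v\<^sub>2\<close> is not a vertex of the join, the two product
    formulas cover all base vertices.\<close>
  show "network_integral J p w a < \<infinity>"
    using w a assms v1 v2 network_integral_join_1[of w a p] network_integral_join_2[of w a p]
    by (cases "w \<in> verts G\<^sub>1") (auto simp: verts_join integrable_network_def ennreal_mult_less_top)
qed

end

theorem theorem3:
  shows
    "(\<forall>(G :: ('a, 'b) pre_digraph) (G' :: ('a, 'b) pre_digraph).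
        integrable_graph G \<and> adds_vertex G G' \<and>
        finite (arcs G' - arcs G) \<and> card (arcs G' - arcs G) \<ge> 3
        \<longrightarrow> integrable_graph G') \<and>
     (\<forall>(G :: ('a, 'b) pre_digraph) (G' :: ('a, 'b) pre_digraph).
        integrable_graph G \<and> adds_edges G G' \<and> finite (arcs G' - arcs G)
        \<longrightarrow> integrable_graph G') \<and>
     (\<forall>(G\<^sub>1 :: ('a, 'b) pre_digraph) (G\<^sub>2 :: ('a, 'b) pre_digraph) v\<^sub>1 v\<^sub>2.
        integrable_graph G\<^sub>1 \<and> integrable_graph G\<^sub>2 \<and>
        verts G\<^sub>1 \<inter> verts G\<^sub>2 = {} \<and> arcs G\<^sub>1 \<inter> arcs G\<^sub>2 = {} \<and>
        v\<^sub>1 \<in> verts G\<^sub>1 \<and> v\<^sub>2 \<in> verts G\<^sub>2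
        \<longrightarrow> integrable_graph (join_at G\<^sub>1 v\<^sub>1 G\<^sub>2 v\<^sub>2))"
proof (intro conjI allI impI; elim conjE)
  fix G G' :: "('a, 'b) pre_digraph"
  assume G: "integrable_graph G" and A: "adds_vertex G G'"
    and fin: "finite (arcs G' - arcs G)" and card: "card (arcs G' - arcs G) \<ge> 3"
  have fG: "fin_conn_graph G" using G by (simp add: integrable_graph_def)
  have "arcs G' - arcs G \<noteq> {}" using card by (metis card.empty not_numeral_le_zero)
  then have fG': "fin_conn_graph G'" by (rule fin_conn_graph_adds_vertex[OF fG A fin])
  \<comment> \<open>Labels that are nonnegative on the arcs of \<open>G'\<close> are nonnegative on
    those of \<open>G\<close>, so integrability of \<open>G\<close> applies to the same
    labelling.\<close>
  have "arcs G \<subseteq> arcs G'" using A by (auto simp: adds_vertex_def keeps_edges_def)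
  then show "integrable_graph G'"
    using G fG' integrable_network_adds_vertex[OF fG fG' A card]
    unfolding integrable_graph_def by blast
next
  fix G G' :: "('a, 'b) pre_digraph"
  assume G: "integrable_graph G" and A: "adds_edges G G'" and fin: "finite (arcs G' - arcs G)"
  have fG: "fin_conn_graph G" using G by (simp add: integrable_graph_def)
  have fG': "fin_conn_graph G'" by (rule fin_conn_graph_adds_edges[OF fG A fin])
  have "arcs G \<subseteq> arcs G'" using A by (auto simp: adds_edges_def keeps_edges_def)
  then show "integrable_graph G'"
    using G fG' integrable_network_adds_edges[OF fG fG' A]
    unfolding integrable_graph_def by blast
next
  fix G\<^sub>1 G\<^sub>2 :: "('a, 'b) pre_digraph" and v\<^sub>1 v\<^sub>2 :: 'a
  assume I: "integrable_graph G\<^sub>1" "integrable_graph G\<^sub>2"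
    and "verts G\<^sub>1 \<inter> verts G\<^sub>2 = {}" "arcs G\<^sub>1 \<inter> arcs G\<^sub>2 = {}" "v\<^sub>1 \<in> verts G\<^sub>1" "v\<^sub>2 \<in> verts G\<^sub>2"
  then interpret disjoint_graphs G\<^sub>1 G\<^sub>2 v\<^sub>1 v\<^sub>2
    by (unfold_locales) (auto simp: integrable_graph_def)
  show "integrable_graph (join_at G\<^sub>1 v\<^sub>1 G\<^sub>2 v\<^sub>2)"
    using I fin_conn_graph_join integrable_network_join
    by (simp add: integrable_graph_def arcs_join)
qed

end
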